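(* (i) If $G$ is the oriented graph of the path $P_n$ ($n\geq2$) in which all arcs have the same direction (i.e. the arcs are $v_i\to v_{i+1}$ for the path $v_1,\dots,v_n$), then the spectrum of the integrated Laplacian matrix $\mathcal{I}^L(G)$ is $2^{(n-1)}$, $0^{(n+1)}$. (ii) If $G$ is the oriented graph of the cycle $C_n$ ($n\geq3$) in which all arcs have the same direction, then the spectrum of $\mathcal{I}^L(G)$ is $2^{(n)}$, $0^{(n)}$. (iii) If $G$ is the oriented graph of the cycle $C_n$ ($n\geq4$) in which consecutive arcs have alternating directions, then the spectrum of $\mathcal{I}^L(G)$ is $0^{(n)}$ together with $2-2\cos\frac{2\pi k}{n}$ (each with multiplicity one) for $k=1,2,\ldots,n$.
   Context: An oriented graph of a graph $H$ is the directed graph (mixed graph with no edges) obtained from $H$ by replacing each edge by a single arc. $\lambda^{(t)}$ denotes an eigenvalue of multiplicity $t$. For a mixed graph $G$ (vertex set, multiset of edges, multiset of arcs) with $V_G=\{v_1,\dots,v_n\}$: $d(v)$ is the number of edges at $v$, $d^+(v)$ (resp. $d^-(v)$) the number of arcs starting (resp. ending) at $v$. The integrated adjacency matrix $\mathcal{I}(G)$ is the $2n\times 2n$ matrix indexed by $v'_1,\dots,v'_n,v''_1,\dots,v''_n$ whose $(v'_i,v'_j)$ and $(v''_i,v''_j)$ entries are the number of edges joining $v_i,v_j$ (and $2\times$ the number of loops when $i=j$) and whose $(v'_i,v''_j)$ and $(v''_j,v'_i)$ entries are the number of arcs from $v_i$ to $v_j$. The integrated degree matrix $\mathcal{I}^D(G)$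 is diagonal with $(v'_i,v'_i)$ entry $d(v_i)+d^+(v_i)$ and $(v''_i,v''_i)$ entry $d(v_i)+d^-(v_i)$, and $\mathcal{I}^L(G)=\mathcal{I}^D(G)-\mathcal{I}(G)$. *)

theory Defs
  imports Complex_Main "HOL-Library.Multiset" "HOL-Library.Uprod"
    "Jordan_Normal_Form.Char_Poly"
begin

text \<open>Edges are unordered pairs, so \<open>Upair v v\<close> is a loop. Both edges and arcs may be multiple.
  A loop is counted once in the number of edges at its vertex.\<close>

record 'a mixed_graph =
  verts :: "'a set"
  edges :: "'a uprod multiset"
  arcs :: "('a \<times> 'a) multiset"

definition edge_degree :: "'a mixed_graph \<Rightarrow> 'a \<Rightarrow> nat" where
  "edge_degree G v = size {#e \<in># edges G. v \<in> set_uprod e#}"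

definition out_degree :: "'a mixed_graph \<Rightarrow> 'a \<Rightarrow> nat" where
  "out_degree G v = size {#a \<in># arcs G. fst a = v#}"

definition in_degree :: "'a mixed_graph \<Rightarrow> 'a \<Rightarrow> nat" where
  "in_degree G v = size {#a \<in># arcs G. snd a = v#}"

text \<open>
  In the matrices below, the list \<open>vs\<close> is an enumeration without repetition of the vertex set,
  with \<open>n\<close> entries. Index \<open>i < n\<close> stands for the first copy \<open>v'\<close> of the vertex \<open>v = vs ! i\<close>, and
  index \<open>n + i\<close> for its second copy \<open>v''\<close>.
\<close>

definition edge_matrix :: "'a list \<Rightarrow> 'a mixed_graph \<Rightarrow> real mat" where
  "edge_matrix vs G = mat (length vs) (length vs) (\<lambda>(i, j).
     if i = j then 2 * real (count (edges G) (Upair (vs ! i) (vs ! i)))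
     else real (count (edges G) (Upair (vs ! i) (vs ! j))))"

definition arc_matrix :: "'a list \<Rightarrow> 'a mixed_graph \<Rightarrow> real mat" where
  "arc_matrix vs G = mat (length vs) (length vs) (\<lambda>(i, j).
     real (count (arcs G) (vs ! i, vs ! j)))"

definition integrated_adjacency :: "'a list \<Rightarrow> 'a mixed_graph \<Rightarrow> real mat" where
  "integrated_adjacency vs G = four_block_mat
     (edge_matrix vs G)               (arc_matrix vs G)
     (transpose_mat (arc_matrix vs G)) (edge_matrix vs G)"

definition integrated_degree :: "'a list \<Rightarrow> 'a mixed_graph \<Rightarrow> real mat" where
  "integrated_degree vs G = four_block_mat
     (mat_diag (length vs) (\<lambda>i. real (edge_degree G (vs ! i) + out_degree G (vs ! i))))
     (0\<^sub>m (length vs) (length vs))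
     (0\<^sub>m (length vs) (length vs))
     (mat_diag (length vs) (\<lambda>i. real (edge_degree G (vs ! i) + in_degree G (vs ! i))))"

definition integrated_laplacian :: "'a list \<Rightarrow> 'a mixed_graph \<Rightarrow> real mat" where
  "integrated_laplacian vs G = integrated_degree vs G - integrated_adjacency vs G"

text \<open>
  Eigenvalues with algebraic multiplicity. For the real symmetric matrices considered here
  all complex eigenvalues are real and geometric and algebraic multiplicities agree.
\<close>

definition eigenvalue_mset :: "real mat \<Rightarrow> real multiset" where
  "eigenvalue_mset A = proots (char_poly A)"

text \<open>The path and, for at least 3 vertices, the cycle through the distinct vertices listed
  in \<open>us\<close>, in this order.\<close>

definition path_graph :: "'a list \<Rightarrow> 'a mixed_graph" where
  "path_graph us = \<lparr>
     verts = set us,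
     edges = {#Upair (us ! i) (us ! Suc i). i \<in># mset_set {i. Suc i < length us}#},
     arcs = {#}\<rparr>"

definition cycle_graph :: "'a list \<Rightarrow> 'a mixed_graph" where
  "cycle_graph us = \<lparr>
     verts = set us,
     edges = {#Upair (us ! i) (us ! (Suc i mod length us)). i \<in># mset_set {..<length us}#},
     arcs = {#}\<rparr>"

text \<open>Forgetting the directions of the arcs of \<open>G\<close> must give back the edges of \<open>H\<close>.\<close>

definition oriented_graph_of :: "'a mixed_graph \<Rightarrow> 'a mixed_graph \<Rightarrow> bool" where
  "oriented_graph_of G H \<longleftrightarrow>
     arcs H = {#} \<and> edges G = {#} \<and> verts G = verts H \<and>
     image_mset (\<lambda>(u, v). Upair u v) (arcs G) = edges H"

text \<open>
  The edge between the \<open>i\<close>-th vertex of the cycle and its cyclic successor is oriented towards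
  the successor. In an orientation of a cycle of length at least 3, exactly one of the two
  possible arcs is present, so otherwise it is oriented the other way.
\<close>

definition forward_arc :: "'a list \<Rightarrow> 'a mixed_graph \<Rightarrow> nat \<Rightarrow> bool" where
  "forward_arc us G i \<longleftrightarrow> (us ! i, us ! (Suc i mod length us)) \<in># arcs G"

definition same_direction_cycle :: "'a list \<Rightarrow> 'a mixed_graph \<Rightarrow> bool" where
  "same_direction_cycle us G \<longleftrightarrow>
     (\<forall>i < length us. \<forall>j < length us. forward_arc us G i \<longleftrightarrow> forward_arc us G j)"

text \<open>Consecutiveness is cyclic, so this is only possible for cycles of even length.\<close>

definition alternating_cycle :: "'a list \<Rightarrow> 'a mixed_graph \<Rightarrow> bool" where
  "alternating_cycle us G \<longleftrightarrow>
     (\<forall>i < length us. forward_arc us G i \<longleftrightarrow> \<not> forward_arc us G (Suc i mod length us))"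

text \<open>The reverse direction of the whole path is obtained by reversing \<open>us\<close>.\<close>

definition same_direction_path :: "'a list \<Rightarrow> 'a mixed_graph \<Rightarrow> bool" where
  "same_direction_path us G \<longleftrightarrow>
     (\<forall>i. Suc i < length us \<longrightarrow> (us ! i, us ! Suc i) \<in># arcs G)"

end

theory Submission imports Defs begin

text \<open>
  For a mixed graph without edges, the integrated Laplacian is the ordinary Laplacian of the
  bipartite double cover, in which each arc \<open>u \<rightarrow> v\<close> becomes an undirected edge between \<open>u'\<close> and
  \<open>v''\<close>. For paths and cycles with all arcs in the same direction this cover is a matching plus
  isolated vertices; for an alternating cycle it is the cycle \<open>C\<^sub>n\<close> (on the \<open>u'\<close> of the sources and
  the \<open>v''\<close> of the sinks) plus \<open>n\<close> isolated vertices. In each case an explicit orthogonal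
  eigenbasis diagonalises the matrix; for \<open>C\<^sub>n\<close> it is the real Hartley basis
  \<open>j \<mapsto> cos (2 \<pi> k j / n) + sin (2 \<pi> k j / n)\<close>.
\<close>

section \<open>Characteristic polynomials from orthogonal eigenvectors\<close>

text \<open>Pairwise orthogonal eigenvectors with nonzero square sums form a matrix whose inverse is
  its rescaled transpose, so \<open>A\<close> is similar to a diagonal matrix. Labels come from any
  finite set \<open>K\<close>, so no numbering of the eigenvectors has to be chosen. Over a general
  field a nonzero vector can be self-orthogonal, hence \<open>norm\<close>.\<close>

lemma char_poly_orthogonal_eigenbasis:
  fixes A :: "'a::field mat" and w :: "'k \<Rightarrow> 'i \<Rightarrow> 'a"
  assumes A: "A \<in> carrier_mat m m"
    and f: "bij_betw f {..<m} X"
    and K: "finite K" "card K = m"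
    and eig: "\<And>k i. k \<in> K \<Longrightarrow> i < m \<Longrightarrow> (\<Sum>j<m. A $$ (i, j) * w k (f j)) = d k * w k (f i)"
    and orth: "\<And>k l. k \<in> K \<Longrightarrow> l \<in> K \<Longrightarrow> k \<noteq> l \<Longrightarrow> (\<Sum>x\<in>X. w k x * w l x) = 0"
    and norm: "\<And>k. k \<in> K \<Longrightarrow> (\<Sum>x\<in>X. w k x * w k x) \<noteq> 0"
  shows "char_poly A = (\<Prod>k\<in>K. [:- d k, 1:])"
proof -
  obtain g where g: "bij_betw g {..<m} K"
    using ex_bij_betw_nat_finite[OF K(1)] K(2) by (auto simp: atLeast0LessThan)
  have gK: "g i \<in> K" if "i < m" for i using g that by (auto simp: bij_betw_def)
  have g_eq: "g i = g j \<longleftrightarrow> i = j" if "i < m" "j < m" for i j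
    using g that by (auto simp: bij_betw_def inj_on_def)
  \<comment> \<open>\<open>P\<close> has the eigenvectors as columns; \<open>Q\<close> is its
    transpose with row \<open>i\<close> divided by \<open>c i\<close>.\<close>
  define c where "c i = (\<Sum>x\<in>X. w (g i) x * w (g i) x)" for i
  define P where "P = mat m m (\<lambda>(i, j). w (g j) (f i))"
  define Q where "Q = mat m m (\<lambda>(i, j). w (g i) (f j) / c i)"
  define D where "D = mat_diag m (\<lambda>i. d (g i))"
  have carr: "P \<in> carrier_mat m m" "Q \<in> carrier_mat m m" "D \<in> carrier_mat m m"
    by (auto simp: P_def Q_def D_def)
  have "Q * P = 1\<^sub>m m"
  proof (rule eq_matI)
    fix i j assume "i < dim_row (1\<^sub>m m :: 'a mat)" "j < dim_col (1\<^sub>m m :: 'a mat)"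
    then have ij: "i < m" "j < m" by auto
    have "(Q * P) $$ (i, j) = (\<Sum>k<m. w (g i) (f k) / c i * w (g j) (f k))"
      using ij carr by (simp add: Q_def P_def scalar_prod_def atLeast0LessThan)
    also have "\<dots> = (\<Sum>k<m. w (g i) (f k) * w (g j) (f k)) / c i"
      by (simp add: sum_divide_distrib)
    also have "\<dots> = (\<Sum>x\<in>X. w (g i) x * w (g j) x) / c i"
      by (subst sum.reindex_bij_betw[OF f, symmetric]) simp
    also have "\<dots> = 1\<^sub>m m $$ (i, j)"
      using ij orth[of "g i" "g j"] norm[of "g i"] gK g_eq[OF ij] by (auto simp: c_def)
    finally show "(Q * P) $$ (i, j) = 1\<^sub>m m $$ (i, j)" .
  qed (use carr in auto)
  moreover from this have "P * Q = 1\<^sub>m m"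
    using mat_mult_left_right_inverse[OF carr(2,1)] by blast
  \<comment> \<open>Column \<open>j\<close> of this identity is the eigenvalue equation of
    \<open>w (g j)\<close>.\<close>
  moreover have "A * P = P * D"
  proof (rule eq_matI)
    fix i j assume "i < dim_row (P * D)" "j < dim_col (P * D)"
    then have ij: "i < m" "j < m" using carr by auto
    have "(A * P) $$ (i, j) = (\<Sum>k<m. A $$ (i, k) * w (g j) (f k))"
      using ij A carr by (simp add: P_def scalar_prod_def atLeast0LessThan)
    also have "\<dots> = (P * D) $$ (i, j)"
      using ij carr gK eig by (simp add: D_def mat_diag_mult_right[of _ m] P_def)
    finally show "(A * P) $$ (i, j) = (P * D) $$ (i, j)" .
  qed (use A carr in auto)
  ultimately have "A = P * D * Q"
    using A carr by (metis assoc_mult_mat right_mult_one_mat)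
  with \<open>Q * P = 1\<^sub>m m\<close> \<open>P * Q = 1\<^sub>m m\<close> A carr have "similar_mat A D"
    by (intro similar_matI[of _ _ P Q m]) auto
  then have "char_poly A = char_poly D" by (rule char_poly_similar)
  also have "\<dots> = (\<Prod>a\<leftarrow>diag_mat D. [:- a, 1:])"
    using carr by (intro char_poly_upper_triangular) (auto simp: D_def mat_diag_def)
  also have "\<dots> = (\<Prod>i\<leftarrow>[0..<m]. [:- d (g i), 1:])"
    by (rule arg_cong[where f = prod_list]) (auto simp: diag_mat_def D_def mat_diag_def)
  also have "\<dots> = (\<Prod>i<m. [:- d (g i), 1:])"
    by (simp add: prod.distinct_set_conv_list[symmetric] atLeast0LessThan)
  also have "\<dots> = (\<Prod>k\<in>K. [:- d k, 1:])"
    by (rule prod.reindex_bij_betw[OF g])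
  finally show ?thesis .
qed

lemma sum_singleton_mset: "finite K \<Longrightarrow> (\<Sum>k\<in>K. {#d k#}) = {#d k. k \<in># mset_set K#}"
  by (induction K rule: finite_induct) auto

corollary eigenvalue_mset_orthogonal_eigenbasis:
  fixes A :: "real mat" and w :: "'k \<Rightarrow> 'i \<Rightarrow> real"
  assumes "A \<in> carrier_mat m m" "bij_betw f {..<m} X" "finite K" "card K = m"
    and "\<And>k i. k \<in> K \<Longrightarrow> i < m \<Longrightarrow> (\<Sum>j<m. A $$ (i, j) * w k (f j)) = d k * w k (f i)"
    and "\<And>k l. k \<in> K \<Longrightarrow> l \<in> K \<Longrightarrow> k \<noteq> l \<Longrightarrow> (\<Sum>x\<in>X. w k x * w l x) = 0"
    and "\<And>k. k \<in> K \<Longrightarrow> (\<Sum>x\<in>X. w k x * w k x) \<noteq> 0"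
  shows "eigenvalue_mset A = {#d k. k \<in># mset_set K#}"
proof -
  have "char_poly A = (\<Prod>k\<in>K. [:- d k, 1:])"
    using assms by (rule char_poly_orthogonal_eigenbasis)
  then show ?thesis
    using assms(3) by (simp add: eigenvalue_mset_def proots_prod sum_singleton_mset)
qed

section \<open>The integrated Laplacian as an operator on vertex copies\<close>

text \<open>In pairs \<open>(v, b)\<close> below, \<open>b = False\<close> stands for the copy \<open>v'\<close> and \<open>b = True\<close> for \<open>v''\<close>.\<close>

definition double_cover_laplacian :: "('a \<times> 'a) set \<Rightarrow> ('a \<times> bool \<Rightarrow> real) \<Rightarrow> 'a \<times> bool \<Rightarrow> real" where
  "double_cover_laplacian A g = (\<lambda>(v, b).
     if b then \<Sum>u | (u, v) \<in> A. g (v, True) - g (u, False)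
     else \<Sum>u | (v, u) \<in> A. g (v, False) - g (u, True))"

definition enum_copies :: "'a list \<Rightarrow> nat \<Rightarrow> 'a \<times> bool" where
  "enum_copies vs p = (if p < length vs then (vs ! p, False) else (vs ! (p - length vs), True))"

lemma bij_betw_enum_copies:
  assumes "distinct vs"
  shows "bij_betw (enum_copies vs) {..<2 * length vs} (set vs \<times> UNIV)"
proof -
  have "inj_on (enum_copies vs) {..<2 * length vs}"
    using assms by (auto simp: inj_on_def enum_copies_def nth_eq_iff_index_eq split: if_splits)
  moreover have "enum_copies vs ` {..<2 * length vs} \<subseteq> set vs \<times> UNIV"
    by (auto simp: enum_copies_def)
  moreover have "card (set vs \<times> (UNIV :: bool set)) = 2 * length vs"
    using assms by (simp add: card_cartesian_product distinct_card)
  ultimately show ?thesis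
    by (simp add: bij_betw_def card_image card_subset_eq)
qed

lemma sum_lessThan_double:
  "(\<Sum>q<2 * n. h q) = (\<Sum>q<n. h q) + (\<Sum>q<n. h (n + q))" for h :: "nat \<Rightarrow> 'b::comm_monoid_add"
  using sum.atLeastLessThan_concat[of 0 n "2 * n" h] sum.shift_bounds_nat_ivl[of h 0 n n]
  by (simp add: atLeast0LessThan mult_2 add.commute)

lemma integrated_laplacian_carrier:
  "integrated_laplacian vs G \<in> carrier_mat (2 * length vs) (2 * length vs)"
  unfolding integrated_laplacian_def integrated_degree_def integrated_adjacency_def
    edge_matrix_def arc_matrix_def by (auto simp: mat_diag_def)

text \<open>Without edges the diagonal blocks hold only out- and in-degrees, and the off-diagonal
  blocks hold negated arc counts, which are 0 or 1 because the arcs form a set. A degree times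
  \<open>g x\<close> is the constant \<open>g x\<close> summed over the neighbours of
  \<open>x\<close>, so both kinds of term merge into one sum of differences.\<close>

lemma integrated_laplacian_mult:
  assumes vs: "distinct vs" and E: "edges G = {#}" and arcs: "arcs G = mset_set A"
    and A: "A \<subseteq> set vs \<times> set vs" and p: "p < 2 * length vs"
  shows "(\<Sum>q<2 * length vs. integrated_laplacian vs G $$ (p, q) * g (enum_copies vs q))
    = double_cover_laplacian A g (enum_copies vs p)"
proof -
  let ?n = "length vs" and ?L = "integrated_laplacian vs G"
  have finA: "finite A" using A finite_subset by blast
  have reindex: "(\<Sum>q<?n. h (vs ! q)) = (\<Sum>v\<in>set vs. h v)" for h :: "'a \<Rightarrow> real"
    using sum.reindex_bij_betw[OF bij_betw_nth[OF vs refl refl], of h] by simp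
  have restrict: "(\<Sum>v\<in>set vs. of_bool (P v) * h v) = (\<Sum>v | P v. h v)"
    if "\<And>v. P v \<Longrightarrow> v \<in> set vs" for P and h :: "'a \<Rightarrow> real"
    using that by (intro sum.mono_neutral_cong_right) auto
  have outd: "out_degree G v = card {u. (v, u) \<in> A}" for v
  proof -
    have "out_degree G v = card {a \<in> A. fst a = v}"
      by (simp add: out_degree_def arcs filter_mset_mset_set[OF finA])
    also have "{a \<in> A. fst a = v} = Pair v ` {u. (v, u) \<in> A}" by auto
    finally show ?thesis by (simp add: card_image inj_on_def)
  qed
  have ind: "in_degree G v = card {u. (u, v) \<in> A}" for v
  proof -
    have "in_degree G v = card {a \<in> A. snd a = v}"
      by (simp add: in_degree_def arcs filter_mset_mset_set[OF finA])
    also have "{a \<in> A. snd a = v} = (\<lambda>u. (u, v)) ` {u. (u, v) \<in> A}" by auto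
    finally show ?thesis by (simp add: card_image inj_on_def)
  qed
  have cnt: "real (count (mset_set A) a) = of_bool (a \<in> A)" for a
    using finA by (simp add: count_mset_set')
  have edeg: "edge_degree G v = 0" for v by (simp add: edge_degree_def E)
  note defs = integrated_laplacian_def integrated_degree_def integrated_adjacency_def
    edge_matrix_def arc_matrix_def mat_diag_def
  have L11: "?L $$ (i, j) = (if i = j then real (card {u. (vs ! i, u) \<in> A}) else 0)"
    if "i < ?n" "j < ?n" for i j
    using that by (auto simp: defs E edeg outd)
  have L12: "?L $$ (i, ?n + j) = - of_bool ((vs ! i, vs ! j) \<in> A)" if "i < ?n" "j < ?n" for i j
    using that by (auto simp: defs arcs cnt)
  have L21: "?L $$ (?n + i, j) = - of_bool ((vs ! j, vs ! i) \<in> A)" if "i < ?n" "j < ?n" for i j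
    using that by (auto simp: defs arcs cnt)
  have L22: "?L $$ (?n + i, ?n + j) = (if i = j then real (card {u. (u, vs ! i) \<in> A}) else 0)"
    if "i < ?n" "j < ?n" for i j
    using that by (auto simp: defs E edeg ind)
  show ?thesis
  proof (cases "p < ?n")
    case True
    have "(\<Sum>q<2 * ?n. ?L $$ (p, q) * g (enum_copies vs q))
      = (\<Sum>q<?n. if p = q then real (card {u. (vs ! p, u) \<in> A}) * g (vs ! p, False) else 0)
        - (\<Sum>q<?n. of_bool ((vs ! p, vs ! q) \<in> A) * g (vs ! q, True))"
      unfolding sum_lessThan_double sum_negf[symmetric] diff_conv_add_uminus
      using True by (intro arg_cong2[where f = "(+)"] sum.cong) (auto simp: L11 L12 enum_copies_def)
    also have "\<dots> = (\<Sum>u | (vs ! p, u) \<in> A. g (vs ! p, False)) - (\<Sum>u | (vs ! p, u) \<in> A. g (u, True))"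
      using True A reindex[of "\<lambda>v. of_bool ((vs ! p, v) \<in> A) * g (v, True)"]
      by (subst restrict[symmetric, of "\<lambda>u. (vs ! p, u) \<in> A" "\<lambda>v. g (v, True)"]) auto
    finally show ?thesis
      using True by (simp add: double_cover_laplacian_def enum_copies_def sum_subtractf)
  next
    case False
    define i where "i = p - ?n"
    have i: "p = ?n + i" "i < ?n" using False p by (auto simp: i_def)
    have "(\<Sum>q<2 * ?n. ?L $$ (p, q) * g (enum_copies vs q))
      = - (\<Sum>q<?n. of_bool ((vs ! q, vs ! i) \<in> A) * g (vs ! q, False))
        + (\<Sum>q<?n. if i = q then real (card {u. (u, vs ! i) \<in> A}) * g (vs ! i, True) else 0)"
      unfolding sum_lessThan_double sum_negf[symmetric] i(1)
      using i(2) by (intro arg_cong2[where f = "(+)"] sum.cong) (auto simp: L21 L22 enum_copies_def)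
    also have "\<dots> = (\<Sum>u | (u, vs ! i) \<in> A. g (vs ! i, True)) - (\<Sum>u | (u, vs ! i) \<in> A. g (u, False))"
      using i(2) A reindex[of "\<lambda>v. of_bool ((v, vs ! i) \<in> A) * g (v, False)"]
      by (subst restrict[symmetric, of "\<lambda>u. (u, vs ! i) \<in> A" "\<lambda>v. g (v, False)"]) auto
    finally show ?thesis
      using i by (simp add: double_cover_laplacian_def enum_copies_def sum_subtractf)
  qed
qed

text \<open>Reduces a spectrum to functions on the vertex copies that satisfy a local equation at
  each copy, so that matrix indices can be left behind.\<close>

lemma integrated_laplacian_spectrum:
  fixes w :: "'k \<Rightarrow> 'a \<times> bool \<Rightarrow> real"
  assumes vs: "distinct vs" and "edges G = {#}" and "arcs G = mset_set A"
    and "A \<subseteq> set vs \<times> set vs"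
    and K: "finite K" "card K = 2 * length vs"
    and eig: "\<And>k v b. k \<in> K \<Longrightarrow> v \<in> set vs \<Longrightarrow>
      double_cover_laplacian A (w k) (v, b) = d k * w k (v, b)"
    and orth: "\<And>k l. k \<in> K \<Longrightarrow> l \<in> K \<Longrightarrow> k \<noteq> l \<Longrightarrow> (\<Sum>x\<in>set vs \<times> UNIV. w k x * w l x) = 0"
    and norm: "\<And>k. k \<in> K \<Longrightarrow> (\<Sum>x\<in>set vs \<times> UNIV. w k x * w k x) \<noteq> 0"
  shows "eigenvalue_mset (integrated_laplacian vs G) = {#d k. k \<in># mset_set K#}"
proof (rule eigenvalue_mset_orthogonal_eigenbasis[OF integrated_laplacian_carrier
      bij_betw_enum_copies[OF vs] K _ orth norm])
  fix k p assume k: "k \<in> K" and p: "p < 2 * length vs"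
  have "enum_copies vs p \<in> set vs \<times> UNIV"
    using bij_betw_enum_copies[OF vs] p by (auto simp: bij_betw_def)
  then obtain v b where "enum_copies vs p = (v, b)" "v \<in> set vs" by auto
  then show "(\<Sum>q<2 * length vs. integrated_laplacian vs G $$ (p, q) * w k (enum_copies vs q))
      = d k * w k (enum_copies vs p)"
    using integrated_laplacian_mult[OF assms(1-4) p, of "w k"] eig[OF k] by simp
qed

section \<open>Orientations as sets of arcs\<close>

text \<open>The underlying edges are pairwise distinct, which rules out both parallel and opposite
  arcs in \<open>M\<close>. Hence each index contributes exactly one of its two possible
  arcs.\<close>

lemma orientation_eq_mset_set:
  assumes M: "image_mset (\<lambda>(u, v). Upair u v) M = {#Upair (a i) (b i). i \<in># mset_set I#}"
    and I: "finite I" and inj: "inj_on (\<lambda>i. Upair (a i) (b i)) I"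
  shows "M = mset_set ((\<lambda>i. if (a i, b i) \<in># M then (a i, b i) else (b i, a i)) ` I)"
proof -
  let ?f = "\<lambda>(u, v). Upair u v" and ?e = "\<lambda>i. Upair (a i) (b i)"
  let ?o = "\<lambda>i. if (a i, b i) \<in># M then (a i, b i) else (b i, a i)"
  have M': "image_mset ?f M = mset_set (?e ` I)"
    using M image_mset_mset_set[OF inj] by simp
  \<comment> \<open>Parallel arcs would give an edge of multiplicity above 1.\<close>
  have "count M x \<le> 1" for x
  proof -
    have "count M x \<le> count (image_mset ?f M) (?f x)"
      by (cases "x \<in># M") (auto simp: count_image_mset not_in_iff intro!: member_le_sum)
    also have "\<dots> \<le> 1" unfolding M' by (simp add: count_mset_set')
    finally show ?thesis .
  qed
  moreover have "x \<in># M \<Longrightarrow> count M x \<ge> 1" for x by simp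
  ultimately have set: "M = mset_set (set_mset M)"
    by (intro multiset_eqI) (metis antisym count_mset_set(1,3) finite_set_mset not_in_iff)
  have fM: "?f ` set_mset M = ?e ` I"
    using arg_cong[OF M', of set_mset] I by simp
  \<comment> \<open>There are as many arcs as edges, so forgetting directions is injective on
    \<open>M\<close>; this excludes opposite arcs.\<close>
  have "card (?f ` set_mset M) = card (set_mset M)"
    unfolding fM using arg_cong[OF M', of size] arg_cong[OF set, of size] by simp
  then have injf: "inj_on ?f (set_mset M)"
    by (intro eq_card_imp_inj_on) auto
  have "set_mset M = ?o ` I"
  proof (intro equalityI subsetI)
    fix x assume x: "x \<in># M"
    then have "?f x \<in> ?e ` I" using fM by blast
    then obtain i where i: "?f x = ?e i" "i \<in> I" by (rule imageE) (rule that)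
    then have "x = (a i, b i) \<or> x = (b i, a i)" by (cases x) (auto simp: Upair_inject)
    moreover have "x = (a i, b i)" if "(a i, b i) \<in># M"
      using inj_onD[OF injf _ x that] i by simp
    ultimately show "x \<in> ?o ` I" using i(2) x by auto
  next
    fix x assume "x \<in> ?o ` I"
    then obtain i where i: "i \<in> I" "x = ?o i" by blast
    from i(1) have "?e i \<in> ?f ` set_mset M" unfolding fM by (rule imageI)
    then obtain y where y: "?e i = ?f y" "y \<in># M" by (rule imageE) (rule that)
    then have "y = (a i, b i) \<or> y = (b i, a i)" by (cases y) (auto simp: Upair_inject)
    then show "x \<in># M" using i(2) y(2) by auto
  qed
  with set show ?thesis by simp
qed

section \<open>Spectrum when the double cover is a matching\<close>

lemma mset_set_two_values:
  assumes "finite K" "S \<subseteq> K"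
  shows "{#if k \<in> S then a else b. k \<in># mset_set K#}
    = replicate_mset (card S) a + replicate_mset (card K - card S) b"
proof -
  have fin: "finite S" "finite (K - S)" using assms finite_subset by auto
  have "mset_set K = mset_set S + mset_set (K - S)"
    using assms fin by (metis Diff_disjoint Diff_partition mset_set_Union)
  moreover have "{#if k \<in> S then a else b. k \<in># mset_set S#} = {#a. k \<in># mset_set S#}"
    using fin by (intro image_mset_cong) auto
  moreover have "{#if k \<in> S then a else b. k \<in># mset_set (K - S)#} = {#b. k \<in># mset_set (K - S)#}"
    using fin by (intro image_mset_cong) auto
  ultimately show ?thesis
    using assms fin by (simp add: image_mset_const_eq card_Diff_subset)
qed

text \<open>By \<open>inj\<close> all out- and in-degrees are at most 1, so every copy has at most
  one neighbour. Each matched pair contributes 2 and 0, each isolated copy 0.\<close>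

lemma integrated_laplacian_spectrum_matching:
  assumes vs: "distinct vs" and E: "edges G = {#}" and arcs: "arcs G = mset_set A"
    and A: "A \<subseteq> set vs \<times> set vs" and inj: "inj_on fst A" "inj_on snd A"
  shows "eigenvalue_mset (integrated_laplacian vs G)
    = replicate_mset (card A) 2 + replicate_mset (2 * length vs - card A) 0"
proof -
  text \<open>An arc \<open>(u, v)\<close> of \<open>A\<close> yields \<open>e\<^bsub>u'\<^esub> - e\<^bsub>v''\<^esub>\<close> (indexed by \<open>u'\<close>) and
    \<open>e\<^bsub>u'\<^esub> + e\<^bsub>v''\<^esub>\<close> (indexed by \<open>v''\<close>); each unmatched copy yields its unit vector.\<close>
  define w :: "'a \<times> bool \<Rightarrow> 'a \<times> bool \<Rightarrow> real" where
    "w = (\<lambda>(u, b) (v, c).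
       if b then if c then of_bool (v = u) else of_bool ((v, u) \<in> A)
       else if c then - of_bool ((u, v) \<in> A) else of_bool (v = u))"
  let ?K = "set vs \<times> (UNIV :: bool set)"
  have cardK: "card ?K = 2 * length vs"
    using vs by (simp add: card_cartesian_product distinct_card)
  have inj1: "x = y" if "(u, x) \<in> A" "(u, y) \<in> A" for u x y
    using inj_onD[OF inj(1) _ that] by simp
  have inj2: "x = y" if "(x, u) \<in> A" "(y, u) \<in> A" for u x y
    using inj_onD[OF inj(2) _ that] by simp
  have out: "{x. (u, x) \<in> A} = {v}" if "(u, v) \<in> A" for u v using that inj1 by blast
  have inn: "{x. (x, v) \<in> A} = {u}" if "(u, v) \<in> A" for u v using that inj2 by blast
  have sum: "(\<Sum>x\<in>?K. h x) = (\<Sum>v\<in>set vs. h (v, False) + h (v, True))" for h :: "_ \<Rightarrow> real"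
    by (simp add: sum.cartesian_product' UNIV_bool)
  \<comment> \<open>The eigenvalue 2 belongs to the difference vectors, which are labelled by the
    first copies of the tails of arcs.\<close>
  have "eigenvalue_mset (integrated_laplacian vs G)
    = {#if k \<in> Domain A \<times> {False} then 2 else 0. k \<in># mset_set ?K#}"
  proof (rule integrated_laplacian_spectrum[OF vs E arcs A, where w = w])
    fix k v b assume "k \<in> ?K" "v \<in> set vs"
    obtain u c where k: "k = (u, c)" by (cases k)
    show "double_cover_laplacian A (w k) (v, b) = (if k \<in> Domain A \<times> {False} then 2 else 0) * w k (v, b)"
    proof (cases b)
      case True
      show ?thesis
      proof (cases "\<exists>x. (x, v) \<in> A")
        case T: True
        then obtain x where "(x, v) \<in> A" by blast
        then show ?thesis using True inn[of x v] inj1[of x u v] inj2[of u v x]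
          by (auto simp: k w_def double_cover_laplacian_def)
      next
        case False
        then show ?thesis using True by (auto simp: k w_def double_cover_laplacian_def)
      qed
    next
      case F: False
      show ?thesis
      proof (cases "\<exists>x. (v, x) \<in> A")
        case True
        then obtain x where "(v, x) \<in> A" by blast
        then show ?thesis using F out[of v x] inj2[of v x u] inj1[of v u x]
          by (auto simp: k w_def double_cover_laplacian_def)
      next
        case False
        then show ?thesis using F by (auto simp: k w_def double_cover_laplacian_def)
      qed
    qed
  next
    fix k l assume kl: "k \<in> ?K" "l \<in> ?K" "k \<noteq> l"
    obtain u b u' c where k: "k = (u, b)" and l: "l = (u', c)" by (cases k, cases l)
    have ne: "u \<noteq> u' \<or> b \<noteq> c" using kl k l by auto
    have u: "u \<in> set vs" "u' \<in> set vs" using kl k l by auto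
    consider "b = c" | "b" "\<not> c" | "\<not> b" "c" by blast
    then show "(\<Sum>x\<in>?K. w k x * w l x) = 0"
    proof cases
      \<comment> \<open>Two vectors labelled by copies of the same kind have disjoint supports,
        since arcs share neither tail nor head.\<close>
      case 1
      then show ?thesis unfolding sum using ne inj1 inj2
        by (intro sum.neutral) (auto simp: k l w_def)
    next
      \<comment> \<open>The supports meet only if both labels belong to one arc; there the products
        1 and -1 cancel.\<close>
      case 2
      then have "(\<Sum>x\<in>?K. w k x * w l x)
        = (\<Sum>v\<in>set vs. (if v = u' then of_bool ((u', u) \<in> A) else 0)
                      - (if v = u then of_bool ((u', u) \<in> A) else 0))"
        unfolding sum by (intro sum.cong) (auto simp: k l w_def)
      then show ?thesis using u by (simp add: sum_subtractf)
    next
      case 3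
      then have "(\<Sum>x\<in>?K. w k x * w l x)
        = (\<Sum>v\<in>set vs. (if v = u then of_bool ((u, u') \<in> A) else 0)
                      - (if v = u' then of_bool ((u, u') \<in> A) else 0))"
        unfolding sum by (intro sum.cong) (auto simp: k l w_def)
      then show ?thesis using u by (simp add: sum_subtractf)
    qed
  next
    fix k assume k: "k \<in> ?K"
    \<comment> \<open>This entry makes the sum of squares positive.\<close>
    moreover have "w k k = 1" by (cases k) (simp add: w_def)
    ultimately show "(\<Sum>x\<in>?K. w k x * w k x) \<noteq> 0"
      using sum_nonneg_eq_0_iff[of ?K "\<lambda>x. w k x * w k x"] by force
  qed (auto simp: cardK)
  also have "\<dots> = replicate_mset (card (Domain A \<times> {False})) 2
      + replicate_mset (card ?K - card (Domain A \<times> {False})) 0"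
    using A by (intro mset_set_two_values) auto
  also have "card (Domain A \<times> {False}) = card A"
    using card_image[OF inj(1)] by (simp add: card_cartesian_product Domain_fst)
  finally show ?thesis by (simp add: cardK)
qed

section \<open>The Hartley basis and its orthogonality\<close>

text \<open>The kernel of the Hartley transform. It gives a real eigenbasis of the cycle labelled
  uniformly by \<open>k\<close>, without the special frequencies that arise when cosines and sines
  are used separately.\<close>

definition cas :: "real \<Rightarrow> real" where
  "cas x = cos x + sin x"

lemma cas_mult: "cas x * cas y = cos (x - y) + sin (x + y)"
  by (simp add: cas_def cos_diff sin_add algebra_simps)

lemma cas_add_diff: "cas (x + t) + cas (x - t) = 2 * cos t * cas x"
  by (simp add: cas_def cos_diff sin_add cos_add sin_diff algebra_simps)

lemma cas_periodic: "cas (x + 2 * pi * real k) = cas x"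
  using cos_2npi[of k] sin_2npi[of k] by (simp add: cas_def cos_add sin_add ac_simps)

text \<open>The summands are the powers of an \<open>n\<close>-th root of unity other than 1, so the
  geometric sum vanishes.\<close>

lemma sum_cis_multiples:
  assumes "n > 0" and "\<not> int n dvd m"
  shows "(\<Sum>j<n. cis (2 * pi * of_int m * real j / real n)) = 0"
proof -
  let ?z = "cis (2 * pi * of_int m / real n)"
  have "?z ^ n = cis (2 * pi * of_int m)" using assms by (simp add: DeMoivre)
  also have "\<dots> = 1" by (simp add: cis_multiple_2pi)
  finally have zn: "?z ^ n = 1" .
  have "?z \<noteq> 1"
  proof
    assume "?z = 1"
    then have "cos (2 * pi * of_int m / real n) = 1" by (simp add: complex_eq_iff)
    then obtain i :: int where "2 * pi * of_int m / real n = of_int i * 2 * pi"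
      using cos_one_2pi_int by blast
    then have "real_of_int m = of_int i * real n" using assms(1) by (simp add: field_simps)
    then have "m = i * int n" by (metis of_int_eq_iff of_int_mult of_int_of_nat_eq)
    with assms(2) show False by simp
  qed
  then have "(\<Sum>j<n. ?z ^ j) = 0" using zn by (simp add: geometric_sum)
  then show ?thesis by (simp add: DeMoivre mult.commute)
qed

text \<open>Unlike for cosines, the case \<open>int n dvd m\<close> needs no exclusion: every angle
  is then a multiple of \<open>2 * pi\<close> and each sine is 0.\<close>

lemma sum_sin_multiples:
  assumes "n > 0"
  shows "(\<Sum>j<n. sin (2 * pi * of_int m * real j / real n)) = 0"
proof (cases "int n dvd m")
  case True
  then obtain i where m: "m = int n * i" by blast
  have "sin (2 * pi * of_int m * real j / real n) = 0" for j
  proof -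
    have "2 * pi * of_int m * real j / real n = of_int (2 * i * int j) * pi"
      using assms by (simp add: m)
    then show ?thesis by (simp only: sin_integer_2pi sin_zero_iff_int2) blast
  qed
  then show ?thesis by simp
next
  case False
  from arg_cong[OF sum_cis_multiples[OF assms this], of Im] show ?thesis by simp
qed

lemma sum_cos_multiples:
  assumes "n > 0" and "\<not> int n dvd m"
  shows "(\<Sum>j<n. cos (2 * pi * of_int m * real j / real n)) = 0"
  using arg_cong[OF sum_cis_multiples[OF assms], of Re] by simp

definition hartley :: "nat \<Rightarrow> nat \<Rightarrow> nat \<Rightarrow> real" where
  "hartley n k j = cas (2 * pi * real k * real j / real n)"

text \<open>By \<open>cas_mult\<close> the sum splits into cosines of frequency \<open>k - l\<close>
  and sines of frequency \<open>k + l\<close>. The sines always cancel; the cosines cancel unless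
  \<open>k = l\<close>, because two labels in \<open>{1..n}\<close> differ by less than
  \<open>n\<close>.\<close>

lemma hartley_orthogonal:
  assumes "n > 0" "k \<in> {1..n}" "l \<in> {1..n}"
  shows "(\<Sum>j<n. hartley n k j * hartley n l j) = (if k = l then real n else 0)"
proof -
  have "(\<Sum>j<n. hartley n k j * hartley n l j)
    = (\<Sum>j<n. cos (2 * pi * of_int (int k - int l) * real j / real n))
      + (\<Sum>j<n. sin (2 * pi * of_int (int k + int l) * real j / real n))"
    unfolding hartley_def cas_mult sum.distrib[symmetric]
    by (intro sum.cong refl arg_cong2[where f = "(+)"] arg_cong[where f = cos] arg_cong[where f = sin])
      (simp_all add: diff_divide_distrib add_divide_distrib algebra_simps)
  also have "\<dots> = (\<Sum>j<n. cos (2 * pi * of_int (int k - int l) * real j / real n))"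
    by (simp only: sum_sin_multiples[OF assms(1)] add_0_right)
  also have "\<dots> = (if k = l then real n else 0)"
  proof (cases "k = l")
    case False
    have "\<not> int n dvd int k - int l"
    proof
      assume "int n dvd int k - int l"
      with False have "int n \<le> \<bar>int k - int l\<bar>" by (intro zdvd_imp_le) auto
      with assms show False by auto
    qed
    from sum_cos_multiples[OF assms(1) this] False show ?thesis by (simp only: if_False)
  qed simp
  finally show ?thesis .
qed

lemma hartley_mod:
  assumes "n > 0"
  shows "hartley n k (j mod n) = hartley n k j"
proof -
  have "2 * pi * real k * real j / real n
      = 2 * pi * real k * real (j mod n) / real n + 2 * pi * real (k * (j div n))"
  proof -
    have "real j = real n * real (j div n) + real (j mod n)"
      by (metis mult_div_mod_eq of_nat_add of_nat_mult)
    then show ?thesis using assms by (simp add: field_simps)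
  qed
  then show ?thesis unfolding hartley_def by (simp only: cas_periodic)
qed

text \<open>A step along the cycle shifts the angle by \<open>2 * pi * k / n\<close>, and
  \<open>cas\<close> satisfies the same sum formula for opposite shifts as the cosine.\<close>

lemma hartley_neighbours:
  assumes "n > 0"
  shows "hartley n k (Suc j mod n) + hartley n k ((j + n - 1) mod n)
    = 2 * cos (2 * pi * real k / real n) * hartley n k j"
proof -
  let ?t = "2 * pi * real k / real n" and ?x = "2 * pi * real k * real j / real n"
  have "hartley n k (Suc j mod n) = cas (?x + ?t)"
    unfolding hartley_mod[OF assms] unfolding hartley_def
    by (rule arg_cong[where f = cas]) (simp add: algebra_simps add_divide_distrib)
  \<comment> \<open>The predecessor is \<open>j + n - 1\<close> to avoid truncated subtraction; the
    added \<open>n\<close> costs \<open>k\<close> full turns.\<close>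
  moreover have "hartley n k ((j + n - 1) mod n) = cas (?x - ?t + 2 * pi * real k)"
    unfolding hartley_mod[OF assms] unfolding hartley_def using assms
    by (intro arg_cong[where f = cas]) (simp add: of_nat_diff field_simps)
  ultimately show ?thesis by (simp only: cas_periodic cas_add_diff) (simp only: hartley_def)
qed


section \<open>Paths and cycles with all arcs in the same direction\<close>

lemma inj_on_path_edges:
  assumes "distinct us"
  shows "inj_on (\<lambda>i. Upair (us ! i) (us ! Suc i)) {i. Suc i < length us}"
  using assms by (auto simp: inj_on_def nth_eq_iff_index_eq)

text \<open>Equal edges at different positions would make the positions successors of each other,
  which happens only on a cycle of length 2.\<close>

lemma inj_on_cycle_edges:
  assumes "distinct us" "length us \<ge> 3"
  shows "inj_on (\<lambda>i. Upair (us ! i) (us ! (Suc i mod length us))) {..<length us}"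
proof (rule inj_onI)
  fix i j assume ij: "i \<in> {..<length us}" "j \<in> {..<length us}"
    and "Upair (us ! i) (us ! (Suc i mod length us)) = Upair (us ! j) (us ! (Suc j mod length us))"
  moreover have "Suc i mod length us < length us" "Suc j mod length us < length us"
    using assms(2) by (auto intro!: mod_less_divisor)
  ultimately have "i = j \<or> i = Suc j mod length us \<and> Suc i mod length us = j"
    using assms(1) by (auto simp: nth_eq_iff_index_eq)
  then show "i = j" using ij assms(2) by (auto simp: mod_Suc split: if_splits)
qed

text \<open>The \<open>n - 1\<close> arcs have distinct tails and distinct heads, so the matching
  lemma applies and leaves \<open>2 * n - (n - 1) = n + 1\<close> zeros.\<close>

lemma integrated_laplacian_spectrum_same_direction_path:
  assumes "distinct vs" "set vs = verts G" "distinct us" "length us = n" "n \<ge> 2"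
    and G: "oriented_graph_of G (path_graph us)" and dir: "same_direction_path us G"
  shows "eigenvalue_mset (integrated_laplacian vs G)
    = replicate_mset (n - 1) 2 + replicate_mset (n + 1) 0"
proof -
  let ?I = "{i. Suc i < n}" and ?A = "(\<lambda>i. (us ! i, us ! Suc i)) ` {i. Suc i < n}"
  have I: "?I = {..<n - 1}" by auto
  have verts: "set vs = set us" and E: "edges G = {#}"
    using G assms by (auto simp: oriented_graph_of_def path_graph_def)
  have len: "length vs = n" using verts assms by (metis distinct_card)
  have "arcs G = mset_set ((\<lambda>i. if (us ! i, us ! Suc i) \<in># arcs G then (us ! i, us ! Suc i)
      else (us ! Suc i, us ! i)) ` ?I)"
    using G assms inj_on_path_edges[of us]
    by (intro orientation_eq_mset_set) (auto simp: I oriented_graph_of_def path_graph_def)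
  also have "(\<lambda>i. if (us ! i, us ! Suc i) \<in># arcs G then (us ! i, us ! Suc i)
      else (us ! Suc i, us ! i)) ` ?I = ?A"
    using dir assms by (intro image_cong) (auto simp: same_direction_path_def)
  finally have arcs: "arcs G = mset_set ?A" .
  have "card ?A = card ?I"
    using assms by (intro card_image) (auto simp: inj_on_def nth_eq_iff_index_eq)
  then have "card ?A = n - 1" by (simp add: I)
  moreover have "inj_on fst ?A" "inj_on snd ?A"
    using assms by (auto simp: inj_on_def nth_eq_iff_index_eq)
  moreover have "?A \<subseteq> set vs \<times> set vs" using verts assms by auto
  ultimately show ?thesis
    using integrated_laplacian_spectrum_matching[OF assms(1) E arcs] assms(5)
    by (simp add: len)
qed

text \<open>The orientation is a predicate on positions, so that constant and alternating directions
  are treated alike.\<close>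

definition cycle_arc :: "'a list \<Rightarrow> (nat \<Rightarrow> bool) \<Rightarrow> nat \<Rightarrow> 'a \<times> 'a" where
  "cycle_arc us fwd i =
    (if fwd i then (us ! i, us ! (Suc i mod length us)) else (us ! (Suc i mod length us), us ! i))"

lemma cycle_arc_in_vertices:
  assumes "i < length us"
  shows "cycle_arc us fwd i \<in> set us \<times> set us"
proof -
  have "Suc i mod length us < length us" using assms by (intro mod_less_divisor) auto
  with assms show ?thesis by (simp add: cycle_arc_def)
qed

lemma arcs_oriented_cycle:
  assumes "distinct us" "length us \<ge> 3" and G: "oriented_graph_of G (cycle_graph us)"
  shows "arcs G = mset_set (cycle_arc us (forward_arc us G) ` {..<length us})"
  using assms inj_on_cycle_edges[of us] unfolding cycle_arc_def[abs_def] forward_arc_def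
  by (intro orientation_eq_mset_set) (auto simp: oriented_graph_of_def cycle_graph_def)

lemma Suc_mod_inject:
  assumes "i < n" "j < n"
  shows "Suc i mod n = Suc j mod n \<longleftrightarrow> i = j"
  using assms by (auto simp: mod_Suc split: if_splits)

lemma integrated_laplacian_spectrum_same_direction_cycle:
  assumes "distinct vs" "set vs = verts G" "distinct us" "length us = n" "n \<ge> 3"
    and G: "oriented_graph_of G (cycle_graph us)" and dir: "same_direction_cycle us G"
  shows "eigenvalue_mset (integrated_laplacian vs G) = replicate_mset n 2 + replicate_mset n 0"
proof -
  let ?A = "cycle_arc us (forward_arc us G) ` {..<n}"
  have verts: "set vs = set us" and E: "edges G = {#}"
    using G assms by (auto simp: oriented_graph_of_def cycle_graph_def)
  have len: "length vs = n" using verts assms by (metis distinct_card)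
  have arcs: "arcs G = mset_set ?A" using arcs_oriented_cycle[OF assms(3) _ G] assms by simp
  have less: "Suc i mod n < n" for i using assms by (auto intro!: mod_less_divisor)
  \<comment> \<open>All arcs agree with the one at position 0: either all run forward or all
    backward, and the two cases only exchange tails and heads.\<close>
  have const: "cycle_arc us (forward_arc us G) i = (if forward_arc us G 0
      then (us ! i, us ! (Suc i mod n)) else (us ! (Suc i mod n), us ! i))" if "i < n" for i
  proof -
    have "0 < length us" "i < length us" using that assms by auto
    then have "forward_arc us G i \<longleftrightarrow> forward_arc us G 0"
      using dir unfolding same_direction_cycle_def by blast
    then show ?thesis by (simp add: cycle_arc_def assms(4))
  qed
  have inj: "inj_on (\<lambda>i. fst (cycle_arc us (forward_arc us G) i)) {..<n}"
    "inj_on (\<lambda>i. snd (cycle_arc us (forward_arc us G) i)) {..<n}"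
    using assms less by (auto simp: inj_on_def const nth_eq_iff_index_eq Suc_mod_inject)
  have "card ?A = n"
    using inj(1) by (subst card_image) (auto simp: inj_on_def)
  moreover have "inj_on fst ?A" "inj_on snd ?A"
    using inj by (auto simp: inj_on_def)
  moreover have "?A \<subseteq> set vs \<times> set vs"
    using cycle_arc_in_vertices[of _ us "forward_arc us G"] unfolding verts assms(4) by blast
  ultimately show ?thesis
    using integrated_laplacian_spectrum_matching[OF assms(1) E arcs] by (simp add: len)
qed

section \<open>The alternating cycle\<close>

text \<open>Only the arcs at position \<open>j\<close> and at its predecessor touch
  \<open>us ! j\<close>. They run in opposite directions along the cycle, so the vertex is a source
  if \<open>fwd j\<close> and a sink otherwise.\<close>

lemma alternating_cycle_neighbours:
  assumes us: "distinct us" "length us = n" "n \<ge> 3" and j: "j < n"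
    and alt: "\<And>i. i < n \<Longrightarrow> fwd i \<longleftrightarrow> \<not> fwd (Suc i mod n)"
  defines "A \<equiv> cycle_arc us fwd ` {..<n}"
    and "N \<equiv> {us ! (Suc j mod n), us ! ((j + n - 1) mod n)}"
  shows "{x. (us ! j, x) \<in> A} = (if fwd j then N else {})"
    and "{x. (x, us ! j) \<in> A} = (if fwd j then {} else N)"
proof -
  define p where "p = (j + n - 1) mod n"
  have p: "p < n" "Suc p mod n = j"
    using j by (auto simp: p_def mod_Suc_eq)
  have less: "Suc i mod n < n" for i using us by (auto intro!: mod_less_divisor)
  have pred: "Suc i mod n = j \<longleftrightarrow> i = p" if "i < n" for i
    using Suc_mod_inject[OF that p(1)] p(2) by simp
  have fp: "fwd p \<longleftrightarrow> \<not> fwd j" using alt[OF p(1)] p(2) by simp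
  have eq: "us ! i = us ! k \<longleftrightarrow> i = k" if "i < n" "k < n" for i k
    using us that by (simp add: nth_eq_iff_index_eq)
  have A: "(x, y) \<in> A \<longleftrightarrow> (\<exists>i<n. if fwd i then x = us ! i \<and> y = us ! (Suc i mod n)
      else x = us ! (Suc i mod n) \<and> y = us ! i)" for x y
    unfolding A_def cycle_arc_def us(2) image_iff Bex_def lessThan_iff
    by (intro ex_cong1 conj_cong refl) auto
  have self: "us ! j = us ! i \<longleftrightarrow> i = j" if "i < n" for i
    using eq[OF j that] by auto
  have succ: "us ! j = us ! (Suc i mod n) \<longleftrightarrow> i = p" if "i < n" for i
    using eq[OF j less] pred[OF that] by auto
  have "(us ! j, y) \<in> A \<longleftrightarrow> (\<exists>i<n. if fwd i then i = j \<and> y = us ! (Suc i mod n) else i = p \<and> y = us ! i)"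
    for y unfolding A using self succ by (intro ex_cong1 conj_cong refl) simp
  then have "(us ! j, y) \<in> A \<longleftrightarrow> fwd j \<and> y \<in> N" for y
    using j p(1) fp unfolding N_def p_def[symmetric] by auto
  then show "{x. (us ! j, x) \<in> A} = (if fwd j then N else {})" by auto
  have "(y, us ! j) \<in> A \<longleftrightarrow> (\<exists>i<n. if fwd i then y = us ! i \<and> i = p else y = us ! (Suc i mod n) \<and> i = j)"
    for y unfolding A using self succ by (intro ex_cong1 conj_cong refl) simp
  then have "(y, us ! j) \<in> A \<longleftrightarrow> \<not> fwd j \<and> y \<in> N" for y
    using j p(1) fp unfolding N_def p_def[symmetric] by auto
  then show "{x. (x, us ! j) \<in> A} = (if fwd j then {} else N)" by auto
qed

text \<open>On the nontrivial half of the double cover the operator is 2 minus the two cyclic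
  shifts, so \<open>hartley_neighbours\<close> turns each Hartley vector into an eigenvector for
  \<open>2 - 2 * cos (2 * pi * k / n)\<close>.\<close>

lemma integrated_laplacian_spectrum_alternating_cycle:
  assumes "distinct vs" "set vs = verts G" "distinct us" "length us = n" "n \<ge> 3"
    and G: "oriented_graph_of G (cycle_graph us)" and dir: "alternating_cycle us G"
  shows "eigenvalue_mset (integrated_laplacian vs G)
    = replicate_mset n 0 + {#2 - 2 * cos (2 * pi * real k / real n). k \<in># mset_set {1..n}#}"
proof -
  define fwd where "fwd = forward_arc us G"
  define A where "A = cycle_arc us fwd ` {..<n}"
  have verts: "set vs = set us" and E: "edges G = {#}"
    using G assms by (auto simp: oriented_graph_of_def cycle_graph_def)
  have len: "length vs = n" using verts assms by (metis distinct_card)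
  have arcs: "arcs G = mset_set A"
    using arcs_oriented_cycle[OF assms(3) _ G] assms by (simp add: A_def fwd_def)
  have less: "i mod n < n" for i using assms by (auto intro!: mod_less_divisor)
  have alt: "fwd i \<longleftrightarrow> \<not> fwd (Suc i mod n)" if "i < n" for i
    using dir that assms(4) unfolding alternating_cycle_def fwd_def by blast
  have A: "A \<subseteq> set vs \<times> set vs"
    using cycle_arc_in_vertices[of _ us fwd] unfolding verts A_def assms(4) by blast
  \<comment> \<open>The position of a vertex on the cycle; \<open>vs\<close> may list the vertices
    in another order.\<close>
  define idx where "idx = inv_into {..<n} ((!) us)"
  have bij: "bij_betw ((!) us) {..<n} (set us)"
    using assms by (intro bij_betw_nth) auto
  have idx: "idx (us ! j) = j" if "j < n" for j
    using bij that by (auto simp: idx_def bij_betw_def inv_into_f_f)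
  text \<open>The copies \<open>(us ! j, \<not> fwd j)\<close> form the cycle of the double cover, all others are isolated.
    Both halves carry the Hartley basis, selected by \<open>c\<close>.\<close>
  define w :: "nat \<times> bool \<Rightarrow> 'a \<times> bool \<Rightarrow> real" where
    "w = (\<lambda>(k, c) (v, b). if (b \<longleftrightarrow> fwd (idx v)) = c then 0 else hartley n k (idx v))"
  \<comment> \<open>\<open>c = True\<close> labels the vectors supported on the cycle copies,
    \<open>c = False\<close> those on the isolated copies.\<close>
  define d where "d = (\<lambda>(k, c). if c then 2 - 2 * cos (2 * pi * real k / real n) else 0)"
  let ?K = "{1..n} \<times> (UNIV :: bool set)"
  \<comment> \<open>At each position exactly one copy lies in the half chosen by \<open>c\<close>,
    so different halves give disjoint supports and equal halves give the Hartley inner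
    product.\<close>
  have inner: "(\<Sum>x\<in>set vs \<times> UNIV. w (k, c) x * w (l, c') x)
    = (if c = c' \<and> k = l then real n else 0)" if "k \<in> {1..n}" "l \<in> {1..n}" for k l c c'
  proof -
    have "(\<Sum>x\<in>set vs \<times> UNIV. w (k, c) x * w (l, c') x)
      = (\<Sum>j<n. \<Sum>b\<in>UNIV. w (k, c) (us ! j, b) * w (l, c') (us ! j, b))"
      unfolding verts sum.cartesian_product' sum.reindex_bij_betw[OF bij, symmetric] by (rule refl)
    also have "\<dots> = (\<Sum>j<n. if c = c' then hartley n k j * hartley n l j else 0)"
      by (intro sum.cong) (auto simp: w_def UNIV_bool idx)
    also have "\<dots> = (if c = c' \<and> k = l then real n else 0)"
      using hartley_orthogonal[of n k l] that assms(5) by (cases "c = c'") simp_all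
    finally show ?thesis .
  qed
  have "eigenvalue_mset (integrated_laplacian vs G) = {#d k. k \<in># mset_set ?K#}"
  proof (rule integrated_laplacian_spectrum[OF assms(1) E arcs A, where w = w])
    fix kc v b assume "kc \<in> ?K" "v \<in> set vs"
    obtain k c where kc: "kc = (k, c)" by (cases kc)
    from \<open>v \<in> set vs\<close> obtain j where j: "j < n" "v = us ! j"
      using verts assms(4) by (metis in_set_conv_nth)
    define s p where "s = Suc j mod n" and "p = (j + n - 1) mod n"
    have sp: "s < n" "p < n" "Suc p mod n = j"
      using less j(1) by (auto simp: s_def p_def mod_Suc_eq)
    \<comment> \<open>The two neighbours must be distinct for the degree to be 2; this uses
      \<open>n \<ge> 3\<close>.\<close>
    have "s \<noteq> p"
    proof
      assume "s = p"
      then have "Suc (Suc j mod n) mod n = j" using sp(3) s_def by simp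
      then show False using j(1) assms(5) by (auto simp: mod_Suc split: if_splits)
    qed
    then have ne: "us ! s \<noteq> us ! p" using sp assms by (simp add: nth_eq_iff_index_eq)
    have fwd: "fwd s \<longleftrightarrow> \<not> fwd j" "fwd p \<longleftrightarrow> \<not> fwd j"
      using alt[OF j(1)] alt[OF sp(2)] sp(3) by (auto simp: s_def)
    have nb: "{x. (us ! j, x) \<in> A} = (if fwd j then {us ! s, us ! p} else {})"
      "{x. (x, us ! j) \<in> A} = (if fwd j then {} else {us ! s, us ! p})"
      unfolding A_def s_def p_def
      by (rule alternating_cycle_neighbours[where fwd = fwd, OF assms(3,4,5) j(1)], erule alt)+
    \<comment> \<open>The neighbours of the cycle copy of \<open>us ! j\<close> are the copies
      \<open>fwd j\<close> of \<open>us ! s\<close> and \<open>us ! p\<close>. As \<open>fwd\<close>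
      flips at each step, these are again cycle copies.\<close>
    have L: "double_cover_laplacian A g (us ! j, b) = (if b \<longleftrightarrow> fwd j then 0
      else 2 * g (us ! j, b) - g (us ! s, fwd j) - g (us ! p, fwd j))" for g
      by (cases "fwd j"; cases b) (simp_all add: double_cover_laplacian_def nb ne)
    have w: "w kc (us ! i, b') = (if (b' \<longleftrightarrow> fwd i) = c then 0 else hartley n k i)"
      if "i < n" for i b' using that by (simp add: w_def kc idx)
    have "hartley n k s + hartley n k p = 2 * cos (2 * pi * real k / real n) * hartley n k j"
      unfolding s_def p_def using assms(5) by (intro hartley_neighbours) simp
    then have eig: "2 * hartley n k j - hartley n k s - hartley n k p
        = (2 - 2 * cos (2 * pi * real k / real n)) * hartley n k j"
      by (simp add: left_diff_distrib)
    have dk: "d kc = (if c then 2 - 2 * cos (2 * pi * real k / real n) else 0)"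
      by (simp add: kc d_def)
    show "double_cover_laplacian A (w kc) (v, b) = d kc * w kc (v, b)"
      unfolding j(2) L w[OF j(1)] w[OF sp(1)] w[OF sp(2)] fwd dk
      by (cases "fwd j"; cases b; cases c) (simp_all only: eig simp_thms if_True if_False mult_zero_left mult_zero_right diff_0_right)
  next
    fix x y assume "x \<in> ?K" "y \<in> ?K" "x \<noteq> y"
    then show "(\<Sum>z\<in>set vs \<times> UNIV. w x z * w y z) = 0"
      by (cases x; cases y) (auto simp: inner)
  next
    fix x assume "x \<in> ?K"
    then show "(\<Sum>z\<in>set vs \<times> UNIV. w x z * w x z) \<noteq> 0"
      using assms(5) by (cases x) (simp add: inner)
  qed (auto simp: len card_cartesian_product)
  \<comment> \<open>The labels with \<open>False\<close> yield the \<open>n\<close> zeros, those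
    with \<open>True\<close> the cosine values.\<close>
  also have "mset_set ?K = image_mset (\<lambda>k. (k, False)) (mset_set {1..n})
      + image_mset (\<lambda>k. (k, True)) (mset_set {1..n})"
  proof -
    have "?K = (\<lambda>k. (k, False)) ` {1..n} \<union> (\<lambda>k. (k, True)) ` {1..n}"
      by (auto simp: UNIV_bool)
    then show ?thesis
      by (subst (1 2) image_mset_mset_set) (auto simp: inj_on_def intro!: mset_set_Union)
  qed
  finally show ?thesis by (simp add: d_def multiset.map_comp comp_def image_mset_const_eq)
qed

theorem theorem3p6:
  fixes G :: "'a mixed_graph" and us vs :: "'a list" and n :: nat
  assumes "distinct vs" and "set vs = verts G"
    and "distinct us" and "length us = n"
  shows
    "(n \<ge> 2 \<and> oriented_graph_of G (path_graph us) \<and> same_direction_path us G \<longrightarrow>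
        eigenvalue_mset (integrated_laplacian vs G) =
          replicate_mset (n - 1) 2 + replicate_mset (n + 1) 0) \<and>
     (n \<ge> 3 \<and> oriented_graph_of G (cycle_graph us) \<and> same_direction_cycle us G \<longrightarrow>
        eigenvalue_mset (integrated_laplacian vs G) =
          replicate_mset n 2 + replicate_mset n 0) \<and>
     (n \<ge> 4 \<and> oriented_graph_of G (cycle_graph us) \<and> alternating_cycle us G \<longrightarrow>
        eigenvalue_mset (integrated_laplacian vs G) =
          replicate_mset n 0 + {#2 - 2 * cos (2 * pi * real k / real n). k \<in># mset_set {1..n}#})"
  using integrated_laplacian_spectrum_same_direction_path[OF assms]
    integrated_laplacian_spectrum_same_direction_cycle[OF assms]
    integrated_laplacian_spectrum_alternating_cycle[OF assms]
  by auto

end
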